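(* Let $m$ be a positive integer and let $\tau_{r_i(n_i),\tilde r_i(n_i)}$, $i=1,2,\ldots,m$, be $m$ horizontal class transpositions. Put $N=\mathrm{lcm}(n_1,\ldots,n_m)$ and $p_i=N/n_i$. Then the order of their product satisfies $$\Bigl|\prod_{i=1}^m\tau_{r_i(n_i),\tilde r_i(n_i)}\Bigr|=\Bigl|\prod_{i=1}^m\prod_{k=0}^{p_i-1}(n_ik+r_i,\; n_ik+\tilde r_i)\Bigr|,$$ where on the right-hand side $(u,v)$ denotes the transposition of $u$ and $v$ in the group of permutations of the finite set $\{0,1,\ldots,N-1\}$.
   Context: For integers $0\le r<m$ write $r(m)=r+m\mathbb{Z}$. If $r_1(m_1)\cap r_2(m_2)=\emptyset$, the class transposition $\tau_{r_1(m_1),r_2(m_2)}$ is the permutation of $\mathbb{Z}$ interchanging $r_1+km_1$ and $r_2+km_2$ for every $k\in\mathbb{Z}$ and fixing every other integer. It is horizontal if $m_1=m_2$. The notation $|g|$ denotes the order of a group element $g$. The products $\prod_{i=1}^m$ on both sides are taken in the same order of the index $i$ and with the same composition convention (left to right). *)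

theory Defs
  imports "HOL-Algebra.Bij" "HOL-Algebra.Multiplicative_Group" "HOL-Combinatorics.Transposition"
begin

definition residue_class :: "int \<Rightarrow> int \<Rightarrow> int set" where
  "residue_class r m = {r + k * m | k. True}"

text \<open>
  The function below is the intended permutation only if the two residue classes are disjoint and
  the moduli are positive; under these conditions the quotients are exact, see
  \<open>class_transposition_left\<close>, \<open>class_transposition_right\<close> and \<open>class_transposition_other\<close>.
\<close>

definition class_transposition :: "int \<Rightarrow> int \<Rightarrow> int \<Rightarrow> int \<Rightarrow> int \<Rightarrow> int" where
  "class_transposition r1 m1 r2 m2 x =
    (if x \<in> residue_class r1 m1 then r2 + (x - r1) div m1 * m2
     else if x \<in> residue_class r2 m2 then r1 + (x - r2) div m2 * m1
     else x)"

text \<open>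
  Multiplication in \<^const>\<open>BijGroup\<close> is ordinary composition, the right factor acting first.
  The product of a list is taken left to right, the head of the list acting first, hence the
  swapped arguments.
\<close>

definition perm_prod :: "'a set \<Rightarrow> ('a \<Rightarrow> 'a) list \<Rightarrow> 'a \<Rightarrow> 'a" where
  "perm_prod S fs = foldl (\<lambda>p f. f \<otimes>\<^bsub>BijGroup S\<^esub> p) \<one>\<^bsub>BijGroup S\<^esub> fs"

text \<open>Elements of \<^term>\<open>BijGroup S\<close> are extensional functions, hence the restriction.\<close>

definition transposition_on :: "'a set \<Rightarrow> 'a \<Rightarrow> 'a \<Rightarrow> 'a \<Rightarrow> 'a" where
  "transposition_on S u v = restrict (transpose u v) S"

lemma class_transposition_left:
  assumes "m1 > 0"
  shows "class_transposition r1 m1 r2 m2 (r1 + k * m1) = r2 + k * m2"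
  using assms by (auto simp: class_transposition_def residue_class_def)

lemma class_transposition_right:
  assumes "m2 > 0" "residue_class r1 m1 \<inter> residue_class r2 m2 = {}"
  shows "class_transposition r1 m1 r2 m2 (r2 + k * m2) = r1 + k * m1"
proof -
  have "r2 + k * m2 \<in> residue_class r2 m2"
    by (auto simp: residue_class_def)
  moreover from this have "r2 + k * m2 \<notin> residue_class r1 m1"
    using assms(2) by blast
  ultimately show ?thesis
    using assms(1) by (simp add: class_transposition_def)
qed

lemma class_transposition_other:
  assumes "x \<notin> residue_class r1 m1" "x \<notin> residue_class r2 m2"
  shows "class_transposition r1 m1 r2 m2 x = x"
  using assms by (simp add: class_transposition_def)

lemma class_transposition_involution:
  assumes "m1 > 0" "m2 > 0" "residue_class r1 m1 \<inter> residue_class r2 m2 = {}"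
  shows "class_transposition r1 m1 r2 m2 (class_transposition r1 m1 r2 m2 x) = x"
proof -
  consider k where "x = r1 + k * m1" | k where "x = r2 + k * m2"
    | "x \<notin> residue_class r1 m1" "x \<notin> residue_class r2 m2"
    by (auto simp: residue_class_def)
  then show ?thesis
    using assms
    by cases (simp_all add: class_transposition_left class_transposition_right
        class_transposition_other)
qed

lemma class_transposition_in_BijGroup:
  assumes "m1 > 0" "m2 > 0" "residue_class r1 m1 \<inter> residue_class r2 m2 = {}"
  shows "class_transposition r1 m1 r2 m2 \<in> carrier (BijGroup UNIV)"
proof -
  let ?t = "class_transposition r1 m1 r2 m2"
  have "?t \<circ> ?t = id"
    using class_transposition_involution[OF assms] by (simp add: fun_eq_iff)
  then have "bij ?t"
    using o_bij by blast
  then show ?thesis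
    by (simp add: BijGroup_def Bij_def)
qed

lemma transposition_on_in_BijGroup:
  assumes "u \<in> S" "v \<in> S"
  shows "transposition_on S u v \<in> carrier (BijGroup S)"
proof -
  have "bij_betw (transpose u v) S S"
    by (rule bij_betw_byWitness[where f' = "transpose u v"])
      (use assms in \<open>auto simp: transpose_def\<close>)
  then show ?thesis
    by (simp add: BijGroup_def Bij_def transposition_on_def cong: bij_betw_cong)
qed

lemma perm_prod_in_BijGroup:
  assumes "set fs \<subseteq> carrier (BijGroup S)"
  shows "perm_prod S fs \<in> carrier (BijGroup S)"
proof -
  interpret group "BijGroup S" by (rule group_BijGroup)
  show ?thesis
    using assms by (induction fs rule: rev_induct) (auto simp: perm_prod_def)
qed

lemma perm_prod_apply:
  assumes "set fs \<subseteq> carrier (BijGroup S)" "x \<in> S"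
  shows "perm_prod S fs x = fold (\<lambda>f y. f y) fs x"
  using assms(1)
proof (induction fs rule: rev_induct)
  case Nil
  then show ?case
    using assms(2) by (simp add: perm_prod_def BijGroup_def)
next
  case (snoc f fs)
  then have "f \<in> Bij S" "perm_prod S fs \<in> Bij S"
    using perm_prod_in_BijGroup[of fs S] by (auto simp: BijGroup_def)
  then have "perm_prod S (fs @ [f]) x = f (perm_prod S fs x)"
    using assms(2) by (simp add: perm_prod_def BijGroup_def compose_def)
  with snoc show ?case
    by simp
qed

end

theory Submission
  imports Defs
begin

text \<open>
  A horizontal class transposition modulo \<open>n\<close> never leaves the block
  \<open>{q * n, ..., q * n + n - 1}\<close> containing its argument, and it acts in the same way on every
  block: it swaps the offsets \<open>r\<close> and \<open>r'\<close>
  (\<open>class_transposition_eq_transpose\<close>). Both properties pass from \<open>n\<close> to the multiple \<open>N\<close>, because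
  a block of length \<open>N\<close> is a union of blocks of length \<open>n\<close> (\<open>blockwise_multiple\<close>), and they are
  preserved under composition. So the whole product \<open>F\<close> on the left is blockwise with respect to
  \<open>N\<close>.

  A blockwise permutation is determined by its restriction to the block \<open>{0..N - 1}\<close>, and the same
  holds for its powers. Restriction therefore preserves the order (\<open>ord_restrict_blockwise\<close>).
  It remains to see that the restriction of \<open>F\<close> is the product on the right. Since restriction is
  compatible with products, this concerns one factor at a time: the restriction of one
  class transposition is the product of the swaps taking place in the \<open>N div n\<close> blocks of length \<open>n\<close>
  that make up \<open>{0..N - 1}\<close> (\<open>perm_prod_transpositions_eq_class_transposition\<close>).
\<close>

section \<open>Orders and powers\<close>

text \<open>
  The exponents that kill an element are the multiples of its order, so each order divides the
  other. This includes infinite order, which is represented by \<open>0\<close>.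
\<close>

lemma ord_eqI:
  assumes "group G" "group H" "x \<in> carrier G" "y \<in> carrier H"
    and "\<And>k :: nat. x [^]\<^bsub>G\<^esub> k = \<one>\<^bsub>G\<^esub> \<longleftrightarrow> y [^]\<^bsub>H\<^esub> k = \<one>\<^bsub>H\<^esub>"
  shows "group.ord G x = group.ord H y"
proof (rule dvd_antisym)
  have "x [^]\<^bsub>G\<^esub> group.ord H y = \<one>\<^bsub>G\<^esub>"
    using assms(5) group.pow_ord_eq_1[OF assms(2,4)] by blast
  then show "group.ord G x dvd group.ord H y"
    by (simp only: group.pow_eq_id[OF assms(1,3)])
  have "y [^]\<^bsub>H\<^esub> group.ord G x = \<one>\<^bsub>H\<^esub>"
    using assms(5) group.pow_ord_eq_1[OF assms(1,3)] by blast
  then show "group.ord H y dvd group.ord G x"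
    by (simp only: group.pow_eq_id[OF assms(2,4)])
qed

lemma carrier_BijGroup: "carrier (BijGroup S) = Bij S"
  by (simp add: BijGroup_def)

lemma one_BijGroup: "\<one>\<^bsub>BijGroup S\<^esub> = (\<lambda>x\<in>S. x)"
  by (simp add: BijGroup_def)

lemma mult_BijGroup_apply:
  "f \<in> Bij S \<Longrightarrow> g \<in> Bij S \<Longrightarrow> x \<in> S \<Longrightarrow> (f \<otimes>\<^bsub>BijGroup S\<^esub> g) x = f (g x)"
  by (simp add: BijGroup_def compose_def)

lemma BijGroup_pow_apply:
  assumes "f \<in> carrier (BijGroup S)" "x \<in> S"
  shows "(f [^]\<^bsub>BijGroup S\<^esub> (k :: nat)) x = (f ^^ k) x"
  using assms(2)
proof (induction k arbitrary: x)
  case 0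
  then show ?case
    by (simp add: one_BijGroup)
next
  case (Suc k)
  interpret group "BijGroup S" by (rule group_BijGroup)
  have "f [^]\<^bsub>BijGroup S\<^esub> k \<in> Bij S" and f: "f \<in> Bij S"
    using assms(1) nat_pow_closed[of f k] by (simp_all add: carrier_BijGroup)
  then have "(f [^]\<^bsub>BijGroup S\<^esub> Suc k) x = (f [^]\<^bsub>BijGroup S\<^esub> k) (f x)"
    using Suc.prems by (simp add: mult_BijGroup_apply)
  moreover have "f x \<in> S"
    using f Suc.prems by (auto simp: Bij_def bij_betw_def)
  ultimately show ?case
    using Suc.IH by (simp add: funpow_Suc_right del: funpow.simps)
qed

lemma BijGroup_pow_eq_one_iff:
  assumes "f \<in> carrier (BijGroup S)"
  shows "f [^]\<^bsub>BijGroup S\<^esub> (k :: nat) = \<one>\<^bsub>BijGroup S\<^esub> \<longleftrightarrow> (\<forall>x\<in>S. (f ^^ k) x = x)"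
proof -
  interpret group "BijGroup S" by (rule group_BijGroup)
  have "f [^]\<^bsub>BijGroup S\<^esub> k \<in> extensional S"
    using assms nat_pow_closed[of f k] by (simp add: carrier_BijGroup Bij_def)
  then have "f [^]\<^bsub>BijGroup S\<^esub> k = \<one>\<^bsub>BijGroup S\<^esub> \<longleftrightarrow> (\<forall>x\<in>S. (f [^]\<^bsub>BijGroup S\<^esub> k) x = x)"
    by (auto simp: one_BijGroup intro: extensionalityI)
  then show ?thesis
    by (simp add: BijGroup_pow_apply[OF assms])
qed

section \<open>Blockwise maps\<close>

text \<open>
  With \<open>x div N\<close> as the number of the block containing \<open>x\<close>, the second conjunct says that blocks
  are preserved; the first makes the action on one block determine the action on all of them.
\<close>

definition blockwise :: "int \<Rightarrow> (int \<Rightarrow> int) \<Rightarrow> bool" where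
  "blockwise N F \<longleftrightarrow>
    (\<forall>x c. F (x + N * c) = F x + N * c) \<and> (\<forall>x. F x div N = x div N)"

lemma blockwise_shift: "blockwise N F \<Longrightarrow> F (x + N * c) = F x + N * c"
  by (simp add: blockwise_def)

lemma div_eq_0_iff_in_block: "0 < N \<Longrightarrow> x div N = 0 \<longleftrightarrow> x \<in> {0..N - 1}" for x N :: int
  by (auto simp: zdiv_eq_0_iff)

lemma blockwise_in_block:
  "blockwise N F \<Longrightarrow> 0 < N \<Longrightarrow> x \<in> {0..N - 1} \<Longrightarrow> F x \<in> {0..N - 1}"
  unfolding div_eq_0_iff_in_block[symmetric] by (simp add: blockwise_def)

lemma blockwise_funpow: "blockwise N F \<Longrightarrow> blockwise N (F ^^ k)"
  by (induction k) (simp_all add: blockwise_def)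

lemma blockwise_fold:
  "(\<And>f. f \<in> set fs \<Longrightarrow> blockwise N f) \<Longrightarrow> blockwise N (fold (\<lambda>f y. f y) fs)"
proof (induction fs)
  case (Cons f fs)
  then have "blockwise N f" "blockwise N (fold (\<lambda>f y. f y) fs)"
    by simp_all
  then show ?case
    by (simp add: blockwise_def)
qed (simp add: blockwise_def)

text \<open>Each block of length \<open>n * p\<close> consists of \<open>p\<close> consecutive blocks of length \<open>n\<close>.\<close>

lemma blockwise_multiple:
  assumes "blockwise n F" "0 < p"
  shows "blockwise (n * p) F"
  using assms by (simp add: blockwise_def mult.assoc zdiv_zmult2_eq)

text \<open>
  Every integer is a translate of a point of \<open>{0..N - 1}\<close> by a multiple of \<open>N\<close>, and powers of a
  blockwise map commute with this translation. So a power that fixes \<open>{0..N - 1}\<close> pointwise fixes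
  everything.
\<close>

lemma ord_restrict_blockwise:
  assumes "blockwise N F" "0 < N"
    and F: "F \<in> carrier (BijGroup UNIV)"
    and g: "g \<in> carrier (BijGroup {0..N - 1})"
    and g_eq: "\<And>x. x \<in> {0..N - 1} \<Longrightarrow> g x = F x"
  shows "group.ord (BijGroup UNIV) F = group.ord (BijGroup {0..N - 1}) g"
proof (rule ord_eqI[OF group_BijGroup group_BijGroup F g])
  fix k :: nat
  have pow: "blockwise N (F ^^ j)" for j
    using assms(1) by (rule blockwise_funpow)
  have g_pow: "(g ^^ j) x = (F ^^ j) x" if "x \<in> {0..N - 1}" for j x
    using that blockwise_in_block[OF pow \<open>0 < N\<close>] by (induction j) (simp_all add: g_eq)
  have "(\<forall>x. (F ^^ k) x = x) \<longleftrightarrow> (\<forall>x\<in>{0..N - 1}. (F ^^ k) x = x)"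
  proof (intro iffI allI ballI)
    fix x
    assume "\<forall>x\<in>{0..N - 1}. (F ^^ k) x = x"
    then have "(F ^^ k) (x mod N) = x mod N"
      using \<open>0 < N\<close> by simp
    then show "(F ^^ k) x = x"
      using blockwise_shift[OF pow, of k "x mod N" "x div N"] by simp
  qed simp
  then show "F [^]\<^bsub>BijGroup UNIV\<^esub> k = \<one>\<^bsub>BijGroup UNIV\<^esub> \<longleftrightarrow>
      g [^]\<^bsub>BijGroup {0..N - 1}\<^esub> k = \<one>\<^bsub>BijGroup {0..N - 1}\<^esub>"
    by (simp add: BijGroup_pow_eq_one_iff[OF F] BijGroup_pow_eq_one_iff[OF g] g_pow)
qed

section \<open>Horizontal class transpositions\<close>

lemma mem_residue_class_iff:
  assumes "0 \<le> r" "r < n"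
  shows "x \<in> residue_class r n \<longleftrightarrow> x mod n = r"
proof
  assume "x mod n = r"
  then have "x = r + x div n * n"
    using mod_div_mult_eq[of x n] by simp
  then show "x \<in> residue_class r n"
    unfolding residue_class_def by blast
qed (use assms in \<open>auto simp: residue_class_def\<close>)

text \<open>
  Inside each block a horizontal class transposition is an ordinary transposition. This closed form
  gives both its blockwise nature and its decomposition into transpositions.
\<close>

lemma class_transposition_eq_transpose:
  assumes "0 \<le> r" "r < n" "0 \<le> r'" "r' < n"
  shows "class_transposition r n r' n x = n * (x div n) + transpose r r' (x mod n)"
proof -
  have "(x - x mod n) div n = x div n"
    using assms by (simp add: minus_mod_eq_mult_div)
  moreover have "n * (x div n) + x mod n = x"
    by simp
  ultimately show ?thesis
    using assms by (auto simp: class_transposition_def mem_residue_class_iff transpose_def)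
qed

lemma blockwise_class_transposition:
  assumes "0 \<le> r" "r < n" "0 \<le> r'" "r' < n"
  shows "blockwise n (class_transposition r n r' n)"
proof -
  have "0 \<le> transpose r r' (x mod n) \<and> transpose r r' (x mod n) < n" for x
    using assms by (simp add: transpose_def)
  then show ?thesis
    using assms
    by (simp add: blockwise_def class_transposition_eq_transpose div_pos_pos_trivial algebra_simps)
qed

text \<open>
  The transposition with index \<open>k\<close> moves points of block \<open>k\<close> only and keeps them in that block, so
  of all factors only the one with \<open>k = x div n\<close> can affect \<open>x\<close>.
\<close>

lemma fold_block_transpositions:
  assumes "0 \<le> r" "r < n" "0 \<le> r'" "r' < n" "distinct ks"
    and "\<And>k. k \<in> set ks \<Longrightarrow> n * k + r \<in> S \<and> n * k + r' \<in> S" "x \<in> S"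
  shows "fold (\<lambda>f y. f y) (map (\<lambda>k. transposition_on S (n * k + r) (n * k + r')) ks) x =
    (if x div n \<in> set ks then class_transposition r n r' n x else x)"
  using assms(5-)
proof (induction ks arbitrary: x)
  case Nil
  then show ?case
    by simp
next
  case (Cons k ks)
  let ?\<tau> = "class_transposition r n r' n"
  let ?y = "transposition_on S (n * k + r) (n * k + r') x"
  have y: "?y = (if x div n = k then ?\<tau> x else x)"
  proof -
    have "x = n * k + s \<longleftrightarrow> x div n = k \<and> x mod n = s" if "0 \<le> s" "s < n" for s
      using that by (auto simp: div_pos_pos_trivial)
    then show ?thesis
      using assms(1-4) \<open>x \<in> S\<close>
      by (auto simp: transposition_on_def transpose_def class_transposition_eq_transpose)
  qed
  have "?\<tau> x div n = x div n"
    using blockwise_class_transposition[OF assms(1-4)] by (simp add: blockwise_def)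
  then have "?y div n = x div n"
    by (simp add: y)
  moreover have "?y \<in> S"
    using Cons.prems by (simp add: transposition_on_def transpose_def)
  ultimately show ?case
    using Cons.IH[of ?y] Cons.prems by (auto simp: y)
qed

lemma block_point_bounds:
  fixes n p k s :: int
  assumes "0 \<le> k" "k < p" "0 \<le> s" "s < n"
  shows "n * k + s \<in> {0..n * p - 1}"
proof -
  have "n * (k + 1) \<le> n * p"
    using assms by (intro mult_left_mono) simp_all
  with assms show ?thesis
    by (simp add: algebra_simps)
qed

lemma perm_prod_transpositions_eq_class_transposition:
  fixes r r' n p x :: int
  defines "S \<equiv> {0..n * p - 1}"
  defines "ts \<equiv> map (\<lambda>k. transposition_on S (n * k + r) (n * k + r')) [0..p - 1]"
  assumes bounds: "0 \<le> r" "r < n" "0 \<le> r'" "r' < n" and "0 < p"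
  shows "perm_prod S ts \<in> carrier (BijGroup S)"
    and "x \<in> S \<Longrightarrow> perm_prod S ts x = class_transposition r n r' n x"
proof -
  have mem: "n * k + r \<in> S \<and> n * k + r' \<in> S" if "k \<in> set [0..p - 1]" for k
    using that bounds block_point_bounds[of k p _ n] by (simp add: S_def)
  have ts: "set ts \<subseteq> carrier (BijGroup S)"
    using mem unfolding ts_def set_map by (blast intro: transposition_on_in_BijGroup)
  then show "perm_prod S ts \<in> carrier (BijGroup S)"
    by (rule perm_prod_in_BijGroup)
  assume "x \<in> S"
  have "x div n div p = 0"
    using \<open>x \<in> S\<close> bounds \<open>0 < p\<close> zdiv_zmult2_eq[of p x n] by (simp add: S_def)
  then have "x div n \<in> set [0..p - 1]"
    using div_eq_0_iff_in_block[OF \<open>0 < p\<close>] by simp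
  then have "fold (\<lambda>f y. f y) ts x = class_transposition r n r' n x"
    using fold_block_transpositions[of r n r' "[0..p - 1]" S x] bounds mem \<open>x \<in> S\<close>
    by (simp add: ts_def)
  then show "perm_prod S ts x = class_transposition r n r' n x"
    by (simp only: perm_prod_apply[OF ts \<open>x \<in> S\<close>])
qed

section \<open>The order of a product\<close>

lemma fold_maps_eq_on_block:
  assumes "0 < N" "x \<in> {0..N - 1}"
    and "\<And>i. i \<in> set is \<Longrightarrow> blockwise N (f i)"
    and "\<And>i y. i \<in> set is \<Longrightarrow> y \<in> {0..N - 1} \<Longrightarrow> g i y = f i y"
  shows "fold (\<lambda>h y. h y) (map g is) x = fold (\<lambda>h y. h y) (map f is) x"
  using assms(2-)
proof (induction "is" arbitrary: x)
  case (Cons i "is")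
  have "f i x \<in> {0..N - 1}"
    by (rule blockwise_in_block[OF Cons.prems(2) \<open>0 < N\<close> Cons.prems(1)]) simp
  then have "fold (\<lambda>h y. h y) (map g is) (f i x) = fold (\<lambda>h y. h y) (map f is) (f i x)"
    by (rule Cons.IH) (auto intro: Cons.prems(2,3))
  moreover have "g i x = f i x"
    by (rule Cons.prems(3)[OF _ Cons.prems(1)]) simp
  ultimately show ?case
    by simp
qed simp

theorem proposition3p2:
  fixes m :: nat and r r' n :: "nat \<Rightarrow> int" and N :: int and p :: "nat \<Rightarrow> int"
  assumes "m \<ge> 1"
    and "\<And>i. i \<in> {1..m} \<Longrightarrow> 0 \<le> r i \<and> r i < n i"
    and "\<And>i. i \<in> {1..m} \<Longrightarrow> 0 \<le> r' i \<and> r' i < n i"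
    and "\<And>i. i \<in> {1..m} \<Longrightarrow> residue_class (r i) (n i) \<inter> residue_class (r' i) (n i) = {}"
    and "N = Lcm (n ` {1..m})"
    and "\<And>i. i \<in> {1..m} \<Longrightarrow> p i = N div n i"
  shows
    "group.ord (BijGroup (UNIV :: int set))
       (perm_prod UNIV (map (\<lambda>i. class_transposition (r i) (n i) (r' i) (n i)) [1..<m + 1])) =
     group.ord (BijGroup {0..N - 1})
       (perm_prod {0..N - 1}
         (map (\<lambda>i. perm_prod {0..N - 1}
                 (map (\<lambda>k. transposition_on {0..N - 1} (n i * k + r i) (n i * k + r' i))
                   [0..p i - 1]))
           [1..<m + 1]))"
proof -
  let ?is = "[1..<m + 1]"
  let ?S = "{0..N - 1}"
  define \<tau> where "\<tau> = (\<lambda>i. class_transposition (r i) (n i) (r' i) (n i))"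
  define \<sigma> where "\<sigma> = (\<lambda>i. perm_prod ?S
    (map (\<lambda>k. transposition_on ?S (n i * k + r i) (n i * k + r' i)) [0..p i - 1]))"
  have is_eq: "set ?is = {1..m}"
    by auto
  have n_pos: "0 < n i" if "i \<in> {1..m}" for i
    using assms(2)[OF that] by simp
  have "0 \<notin> n ` {1..m}"
    using n_pos by (metis imageE less_irrefl)
  then have "N \<noteq> 0"
    by (simp add: assms(5) Lcm_0_iff)
  moreover have "0 \<le> N"
    by (simp add: assms(5))
  ultimately have "0 < N"
    by simp
  have N_eq: "N = n i * p i" if "i \<in> {1..m}" for i
    using that by (simp add: assms(5,6))
  have p_pos: "0 < p i" if "i \<in> {1..m}" for i
    using N_eq[OF that] n_pos[OF that] \<open>0 < N\<close> by (simp add: zero_less_mult_iff)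
  have \<tau>_blockwise: "blockwise N (\<tau> i)" if "i \<in> {1..m}" for i
    unfolding \<tau>_def N_eq[OF that]
    using assms(2,3)[OF that] p_pos[OF that]
    by (intro blockwise_multiple blockwise_class_transposition) simp_all
  have \<tau>_carrier: "set (map \<tau> ?is) \<subseteq> carrier (BijGroup UNIV)"
    using n_pos assms(4) unfolding set_map is_eq \<tau>_def
    by (blast intro: class_transposition_in_BijGroup)
  have \<sigma>: "\<sigma> i \<in> carrier (BijGroup ?S)" "\<And>x. x \<in> ?S \<Longrightarrow> \<sigma> i x = \<tau> i x" if "i \<in> {1..m}" for i
    using perm_prod_transpositions_eq_class_transposition[of "r i" "n i" "r' i" "p i"]
      assms(2,3)[OF that] p_pos[OF that]
    unfolding \<sigma>_def \<tau>_def N_eq[OF that] by simp_all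
  then have \<sigma>_carrier: "set (map \<sigma> ?is) \<subseteq> carrier (BijGroup ?S)"
    unfolding set_map is_eq by blast
  have "perm_prod UNIV (map \<tau> ?is) = fold (\<lambda>f y. f y) (map \<tau> ?is)"
    using perm_prod_apply[OF \<tau>_carrier] by (simp add: fun_eq_iff)
  moreover have "blockwise N (fold (\<lambda>f y. f y) (map \<tau> ?is))"
    by (rule blockwise_fold) (use \<tau>_blockwise in auto)
  moreover have "perm_prod ?S (map \<sigma> ?is) x = fold (\<lambda>f y. f y) (map \<tau> ?is) x" if "x \<in> ?S" for x
    unfolding perm_prod_apply[OF \<sigma>_carrier that]
    by (rule fold_maps_eq_on_block[OF \<open>0 < N\<close> that]) (use \<tau>_blockwise \<sigma>(2) in auto)
  ultimately have "group.ord (BijGroup UNIV) (perm_prod UNIV (map \<tau> ?is)) =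
      group.ord (BijGroup ?S) (perm_prod ?S (map \<sigma> ?is))"
    using ord_restrict_blockwise \<open>0 < N\<close> perm_prod_in_BijGroup[OF \<tau>_carrier]
      perm_prod_in_BijGroup[OF \<sigma>_carrier] by simp
  then show ?thesis
    by (simp only: \<tau>_def \<sigma>_def)
qed

end
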